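(* For $q\in\mathbb{C}$ with $|q|<1$, $$\sum_{i,j\geq 0}\frac{q^{4i^2+2ij+\frac{1}{2}j^2-2i+\frac{1}{2}j}}{(q;q)_{2i}(q;q)_{j}}=\frac{1}{(q;q^2)_\infty(q^2;q^4)_\infty},\qquad \sum_{i,j\geq 0} \frac{q^{4i^2+2ij+\frac{1}{2}j^2+2i+\frac{3}{2}j}}{(q;q)_{2i+1}(q;q)_{j}}=\frac{1}{(q;q^2)_\infty(q^2;q^4)_\infty},$$ $$\sum_{i,j\geq 0} \frac{q^{4i^2+2ij+\frac{1}{2}j^2+\frac{1}{2}j}}{(q;q)_{2i}(q;q)_{j}}=\frac{(q^{2},q^{14},q^{16};q^{16})_{\infty}(q^{12},q^{20};q^{32})_{\infty}}{(q;q)_{\infty}},$$ $$\sum_{i,j\geq 0} \frac{q^{4i^2+2ij+\frac{1}{2}j^2+4i+\frac{3}{2}j}}{(q;q)_{2i+1}(q;q)_{j}}=\frac{(q^{6},q^{10},q^{16};q^{16})_{\infty}(q^{4},q^{28};q^{32})_{\infty}}{(q;q)_{\infty}}.$$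
   Context: For $|q|<1$: $(a;q)_\infty=\prod_{k\ge0}(1-aq^k)$; for integers $n\ge0$, $(a;q)_n=\prod_{k=0}^{n-1}(1-aq^k)$; and $(a_1,\dots,a_m;q)_\infty=\prod_{k=1}^m(a_k;q)_\infty$. All exponents of $q$ appearing are integers. *)

theory Defs
  imports "HOL-Analysis.Analysis"
begin

definition qpoch :: "complex \<Rightarrow> complex \<Rightarrow> nat \<Rightarrow> complex" where
  "qpoch a q n = (\<Prod>k<n. 1 - a * q ^ k)"

text \<open>Meaningful for \<open>norm q < 1\<close>, where the product converges
  (\<open>convergent_prod_qpoch_inf\<close> below).\<close>

definition qpoch_inf :: "complex \<Rightarrow> complex \<Rightarrow> complex" where
  "qpoch_inf a q = (\<Prod>k. 1 - a * q ^ k)"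

definition qpochs_inf :: "complex list \<Rightarrow> complex \<Rightarrow> complex" where
  "qpochs_inf as q = (\<Prod>a\<leftarrow>as. qpoch_inf a q)"

lemma convergent_prod_qpoch_inf:
  assumes "norm q < 1"
  shows "convergent_prod (\<lambda>k. 1 - a * q ^ k :: complex)"
proof -
  have "summable (\<lambda>k. norm a * norm q ^ k)"
    using assms by (intro summable_mult summable_geometric) simp
  hence "summable (\<lambda>k. norm ((1 - a * q ^ k) - 1))"
    by (simp add: norm_mult norm_power)
  hence "abs_convergent_prod (\<lambda>k. 1 - a * q ^ k)"
    by (simp add: summable_imp_abs_convergent_prod)
  thus ?thesis
    by (rule abs_convergent_prod_imp_convergent_prod)
qed

text \<open>The exponents of \<open>q\<close> in the theorem are written as natural numbers; the following facts
  show that neither the division by 2 nor the truncated subtraction loses anything.\<close>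

lemma real_half_exponent:
  "real ((j\<^sup>2 + j) div 2) = 1/2 * (real j)\<^sup>2 + 1/2 * real j"
  "real ((j\<^sup>2 + 3 * j) div 2) = 1/2 * (real j)\<^sup>2 + 3/2 * real j"
proof -
  have "2 dvd j\<^sup>2 + j" "2 dvd j\<^sup>2 + 3 * j"
    by simp_all
  thus "real ((j\<^sup>2 + j) div 2) = 1/2 * (real j)\<^sup>2 + 1/2 * real j"
       "real ((j\<^sup>2 + 3 * j) div 2) = 1/2 * (real j)\<^sup>2 + 3/2 * real j"
    by (simp_all add: real_of_nat_div field_simps)
qed

lemma real_exponent_minus:
  "real (4 * i\<^sup>2 + 2 * i * j + (j\<^sup>2 + j) div 2 - 2 * i) =
     4 * (real i)\<^sup>2 + 2 * real i * real j + 1/2 * (real j)\<^sup>2 - 2 * real i + 1/2 * real j"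
proof -
  have "i \<le> i\<^sup>2"
    by (simp add: power2_eq_square)
  hence "2 * i \<le> 4 * i\<^sup>2 + 2 * i * j + (j\<^sup>2 + j) div 2"
    by linarith
  thus ?thesis
    by (simp add: of_nat_diff real_half_exponent del: of_nat_div)
qed

end

theory Submission
  imports Defs
begin

text \<open>
  Summing over \<open>j\<close> with Euler's identity
  \<open>\<Sum> q^(n(n-1)/2) z^n / (q;q)_n = (-z;q)_\<infinity>\<close> turns each double sum into
  \<open>(-q;q)_\<infinity>\<close> times a single sum over \<open>i\<close>, with denominators \<open>(q^2;q^2)_m\<close> for
  \<open>m = 2i\<close> or \<open>m = 2i + 1\<close>. That sum is the even or odd part in \<open>z\<close> of Euler's identity in base
  \<open>q^2\<close>, at \<open>z = 1\<close> for the first two formulas and at \<open>z = q\<close> for the last two.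
  For \<open>z = q\<close>, multiplying \<open>(\<mp>q;q^2)_\<infinity>\<close> by \<open>(q^4;q^4)_\<infinity>\<close> gives the theta series
  \<open>\<Sum> (\<plusminus>q)^s q^(2s(s-1))\<close>, whose terms with even and odd \<open>s\<close> are again theta series, in base
  \<open>q^16\<close>. Euler's identity and the Jacobi triple product are both limits, by dominated
  convergence, of Rothe's finite \<open>q\<close>-binomial theorem.
\<close>

section \<open>Dominated convergence for sums\<close>

text \<open>By the Weierstrass M-test the finite partial sums converge uniformly in
  \<open>N\<close>, so the limit in \<open>N\<close> and the limit along finite subsets may be
  exchanged. The index set is left general because Euler's series runs over the naturals and the
  theta series over the integers.\<close>

lemma has_sum_tannery:
  fixes f :: "nat \<Rightarrow> 'a \<Rightarrow> 'b :: banach"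
  assumes bound: "\<And>N x. x \<in> A \<Longrightarrow> norm (f N x) \<le> M x"
    and summable: "M summable_on A"
    and lim: "\<And>x. x \<in> A \<Longrightarrow> (\<lambda>N. f N x) \<longlonglongrightarrow> g x"
    and sums: "\<And>N. (f N has_sum S N) A"
    and S: "S \<longlonglongrightarrow> L"
  shows "(g has_sum L) A"
proof -
  have "norm (g x) \<le> M x" if "x \<in> A" for x
    using tendsto_norm[OF lim[OF that]] by (rule LIMSEQ_le_const2) (use bound that in auto)
  hence "(\<lambda>x. norm (g x)) summable_on A"
    by (intro summable_on_comparison_test[OF summable]) auto
  hence g: "(g has_sum infsum g A) A"
    by (rule has_sum_infsum[OF abs_summable_summable])
  have "S \<longlonglongrightarrow> infsum g A"
  proof (rule swap_uniform_limit')
    show "uniform_limit UNIV (\<lambda>X N. \<Sum>x\<in>X. f N x) S (finite_subsets_at_top A)"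
      by (rule Weierstrass_m_test_general'[OF _ _ summable]) (use bound sums in auto)
    show "\<forall>\<^sub>F X in finite_subsets_at_top A. (\<lambda>N. \<Sum>x\<in>X. f N x) \<longlonglongrightarrow> sum g X"
      by (rule eventually_finite_subsets_at_top_weakI) (auto intro!: tendsto_sum lim)
    show "(sum g \<longlongrightarrow> infsum g A) (finite_subsets_at_top A)"
      using g by (simp add: has_sum_def)
  qed auto
  with S have "L = infsum g A"
    by (rule LIMSEQ_unique)
  with g show ?thesis
    by simp
qed

section \<open>Triangular exponents and their decay\<close>

lemma Suc_choose_two: "Suc n choose 2 = (n choose 2) + n"
  by (simp add: numeral_2_eq_2)

lemma choose_two_square: "2 * (n choose 2) + n = n\<^sup>2"
  by (induction n) (simp_all add: Suc_choose_two binomial_eq_0 power2_eq_square)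

text \<open>The ratio of consecutive terms is \<open>w * r ^ n\<close>, which tends to 0 however
  large \<open>w\<close> is. This is the majorant for both Euler's series and the theta
  series.\<close>

lemma summable_power_choose_two:
  fixes w r :: real
  assumes "0 \<le> r" "r < 1" "0 \<le> w"
  shows "summable (\<lambda>n. w ^ n * r ^ (n choose 2))"
proof -
  have "(\<lambda>n. w * r ^ n) \<longlonglongrightarrow> w * 0"
    by (intro tendsto_intros LIMSEQ_realpow_zero assms)
  hence "\<forall>\<^sub>F n in sequentially. w * r ^ n < 1 / 2"
    by (rule order_tendstoD) auto
  then obtain N where N: "w * r ^ n < 1 / 2" if "n \<ge> N" for n
    unfolding eventually_sequentially by blast
  show ?thesis
  proof (rule summable_ratio_test[of "1/2" N])
    fix n assume "n \<ge> N"
    have "w ^ Suc n * r ^ (Suc n choose 2) = (w * r ^ n) * (w ^ n * r ^ (n choose 2))"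
      by (simp add: Suc_choose_two power_add)
    also have "\<dots> \<le> 1 / 2 * (w ^ n * r ^ (n choose 2))"
      using N[OF \<open>n \<ge> N\<close>] assms by (intro mult_right_mono) auto
    finally show "norm (w ^ Suc n * r ^ (Suc n choose 2)) \<le> 1 / 2 * norm (w ^ n * r ^ (n choose 2))"
      using assms by simp
  qed auto
qed

section \<open>q-Pochhammer symbols\<close>

lemma qpoch_0 [simp]: "qpoch a q 0 = 1"
  and qpoch_Suc: "qpoch a q (Suc n) = qpoch a q n * (1 - a * q ^ n)"
  by (simp_all add: qpoch_def)

lemma qpoch_0_left [simp]: "qpoch 0 q n = 1"
  and qpoch_inf_0_left [simp]: "qpoch_inf 0 q = 1"
  by (simp_all add: qpoch_def qpoch_inf_def)

lemma qpoch_add: "qpoch a q (m + n) = qpoch a q m * qpoch (a * q ^ m) q n"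
  by (induction n) (simp_all add: qpoch_Suc power_add mult.assoc)

lemma qpoch_mult_minus: "qpoch a q n * qpoch (-a) q n = qpoch (a\<^sup>2) (q\<^sup>2) n"
proof (induction n)
  case (Suc n)
  have "qpoch a q (Suc n) * qpoch (-a) q (Suc n) =
      (qpoch a q n * qpoch (-a) q n) * ((1 - a * q ^ n) * (1 - (-a) * q ^ n))"
    by (simp only: qpoch_Suc mult_ac)
  also have "(1 - a * q ^ n) * (1 - (-a) * q ^ n) = 1 - a\<^sup>2 * (q\<^sup>2) ^ n"
    by (simp add: power2_eq_square power_mult_distrib algebra_simps)
  finally show ?case
    by (simp only: Suc qpoch_Suc)
qed simp

lemma qpoch_split: "qpoch a q (2 * n) = qpoch a (q\<^sup>2) n * qpoch (a * q) (q\<^sup>2) n"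
proof (induction n)
  case (Suc n)
  have "q ^ (2 * n) = (q\<^sup>2) ^ n"
    by (rule power_mult)
  with Suc show ?case
    by (simp add: qpoch_Suc mult_ac)
qed simp

lemma power_Suc_neq_1:
  fixes q :: complex
  assumes "norm q < 1"
  shows "q * q ^ n \<noteq> 1"
proof
  assume "q * q ^ n = 1"
  hence "norm (q ^ Suc n) = 1"
    by simp
  with assms show False
    using power_less_one_iff[of "norm q" "Suc n"] by (simp add: norm_power del: power_Suc)
qed

lemma qpoch_self_nonzero: "norm q < 1 \<Longrightarrow> qpoch q q n \<noteq> 0"
  using power_Suc_neq_1[of q] by (auto simp: qpoch_def)

text \<open>The bridge from finite to infinite products: the rules for \<open>qpoch_inf\<close>
  below are limits of those for \<open>qpoch\<close>, by uniqueness of limits.\<close>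

lemma qpoch_LIMSEQ:
  assumes "norm q < 1"
  shows "(\<lambda>n. qpoch a q n) \<longlonglongrightarrow> qpoch_inf a q"
  unfolding qpoch_def qpoch_inf_def
  by (rule has_prod_imp_tendsto') (intro convergent_prod_has_prod convergent_prod_qpoch_inf assms)

lemma qpoch_inf_self_nonzero: "norm q < 1 \<Longrightarrow> qpoch_inf q q \<noteq> 0"
  unfolding qpoch_inf_def
  by (intro prodinf_nonzero convergent_prod_qpoch_inf) (use power_Suc_neq_1[of q] in auto)

lemma norm_power_less_1:
  fixes q :: complex
  shows "norm q < 1 \<Longrightarrow> n > 0 \<Longrightarrow> norm (q ^ n) < 1"
  by (simp add: norm_power power_less_one_iff)

lemma qpoch_inf_shift:
  assumes "norm q < 1"
  shows "qpoch_inf a q = qpoch a q m * qpoch_inf (a * q ^ m) q"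
proof (rule LIMSEQ_unique)
  show "(\<lambda>n. qpoch a q (m + n)) \<longlonglongrightarrow> qpoch_inf a q"
    using LIMSEQ_ignore_initial_segment[OF qpoch_LIMSEQ[OF assms], of a m] by (simp add: add.commute)
  show "(\<lambda>n. qpoch a q (m + n)) \<longlonglongrightarrow> qpoch a q m * qpoch_inf (a * q ^ m) q"
    unfolding qpoch_add by (intro tendsto_intros qpoch_LIMSEQ assms)
qed

lemma qpoch_inf_mult_minus:
  assumes "norm q < 1"
  shows "qpoch_inf a q * qpoch_inf (-a) q = qpoch_inf (a\<^sup>2) (q\<^sup>2)"
proof (rule LIMSEQ_unique)
  show "(\<lambda>n. qpoch a q n * qpoch (-a) q n) \<longlonglongrightarrow> qpoch_inf a q * qpoch_inf (-a) q"
    by (intro tendsto_intros qpoch_LIMSEQ assms)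
  show "(\<lambda>n. qpoch a q n * qpoch (-a) q n) \<longlonglongrightarrow> qpoch_inf (a\<^sup>2) (q\<^sup>2)"
    unfolding qpoch_mult_minus by (intro qpoch_LIMSEQ norm_power_less_1 assms) simp
qed

lemma qpoch_inf_split:
  assumes "norm q < 1"
  shows "qpoch_inf a q = qpoch_inf a (q\<^sup>2) * qpoch_inf (a * q) (q\<^sup>2)"
proof (rule LIMSEQ_unique)
  show "(\<lambda>n. qpoch a q (2 * n)) \<longlonglongrightarrow> qpoch_inf a q"
    by (rule filterlim_compose[OF qpoch_LIMSEQ[OF assms]])
      (intro filterlim_subseq, auto intro!: strict_monoI)
  show "(\<lambda>n. qpoch a q (2 * n)) \<longlonglongrightarrow> qpoch_inf a (q\<^sup>2) * qpoch_inf (a * q) (q\<^sup>2)"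
    unfolding qpoch_split by (intro tendsto_intros qpoch_LIMSEQ norm_power_less_1 assms) simp_all
qed

section \<open>Rothe's identity and Euler's identity\<close>

text \<open>The Gaussian binomial coefficient. The value 0 for \<open>n > N\<close> lets sums over
  \<open>n\<close> extend to all naturals and makes the Pascal rule valid at
  \<open>n = N\<close>.\<close>

definition gauss_binomial :: "complex \<Rightarrow> nat \<Rightarrow> nat \<Rightarrow> complex" where
  "gauss_binomial q N n =
     (if n \<le> N then qpoch q q N / (qpoch q q n * qpoch q q (N - n)) else 0)"

lemma gauss_binomial_0 [simp]: "norm q < 1 \<Longrightarrow> gauss_binomial q N 0 = 1"
  by (simp add: gauss_binomial_def qpoch_self_nonzero)

lemma gauss_binomial_eq_0 [simp]: "n > N \<Longrightarrow> gauss_binomial q N n = 0"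
  by (simp add: gauss_binomial_def)

text \<open>The q-Pascal rule. Of its two versions, this one carries the weight
  \<open>q ^ (N - n)\<close>, which fits the new factor \<open>1 + z * q ^ N\<close> in Rothe's
  identity.\<close>

lemma gauss_binomial_Suc_Suc:
  assumes "norm q < 1" "n \<le> N"
  shows "gauss_binomial q (Suc N) (Suc n) =
    gauss_binomial q N (Suc n) + q ^ (N - n) * gauss_binomial q N n"
proof (cases "n = N")
  case True
  thus ?thesis using qpoch_self_nonzero[OF assms(1)] by (simp add: gauss_binomial_def)
next
  case False
  then obtain d where N: "N = n + Suc d"
    using assms(2) by (metis add_Suc_right le_neq_implies_less less_imp_Suc_add)
  have nz: "qpoch q q k \<noteq> 0" "1 - q * q ^ k \<noteq> 0" for k
    using qpoch_self_nonzero[OF assms(1), of k] power_Suc_neq_1[OF assms(1), of k] by auto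
  define A B D where "A = qpoch q q n" and "B = qpoch q q d" and "D = qpoch q q (n + d) * (1 - q * q ^ (n + d))"
  define x y where "x = q ^ n" and "y = q ^ d"
  have nz': "A \<noteq> 0" "B \<noteq> 0" "1 - q * x \<noteq> 0" "1 - q * y \<noteq> 0"
    unfolding A_def B_def x_def y_def by (rule nz)+
  \<comment> \<open>Here \<open>D\<close> is \<open>qpoch q q N\<close>. After clearing denominators
    this is \<open>1 - q * q * x * y = (1 - q * y) + q * y * (1 - q * x)\<close>.\<close>
  have "D * (1 - q * (x * (q * y))) / (A * (1 - q * x) * (B * (1 - q * y))) =
      D / (A * (1 - q * x) * B) + (q * y) * (D / (A * (B * (1 - q * y))))"
    using nz' by (simp add: divide_simps) (simp add: algebra_simps)
  thus ?thesis
    by (simp add: gauss_binomial_def N qpoch_Suc A_def B_def D_def x_def y_def power_add mult_ac)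
qed

lemma rothe:
  assumes "norm q < 1"
  shows "qpoch (-z) q N = (\<Sum>n\<le>N. gauss_binomial q N n * q ^ (n choose 2) * z ^ n)"
proof (induction N)
  case (Suc N)
  let ?t = "\<lambda>n. gauss_binomial q N n * q ^ (n choose 2) * z ^ n"
  have "(\<Sum>n\<le>Suc N. gauss_binomial q (Suc N) n * q ^ (n choose 2) * z ^ n) =
      1 + (\<Sum>n\<le>N. gauss_binomial q (Suc N) (Suc n) * q ^ (Suc n choose 2) * z ^ Suc n)"
    by (subst sum.atMost_Suc_shift) (simp add: assms binomial_eq_0)
  also have "(\<Sum>n\<le>N. gauss_binomial q (Suc N) (Suc n) * q ^ (Suc n choose 2) * z ^ Suc n) =
      (\<Sum>n\<le>N. ?t (Suc n) + z * q ^ N * ?t n)"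
  proof (rule sum.cong)
    fix n assume "n \<in> {..N}"
    hence n: "n \<le> N" by simp
    \<comment> \<open>The factor \<open>q ^ n\<close> comes from \<open>Suc n choose 2\<close>;
      together with the Pascal weight it gives a power independent of \<open>n\<close>, so
      \<open>z * q ^ N\<close> can be pulled out of the sum.\<close>
    have "q ^ N = q ^ (N - n) * q ^ n"
      using n by (simp flip: power_add)
    thus "gauss_binomial q (Suc N) (Suc n) * q ^ (Suc n choose 2) * z ^ Suc n =
        ?t (Suc n) + z * q ^ N * ?t n"
      by (simp add: gauss_binomial_Suc_Suc[OF assms n] Suc_choose_two power_add algebra_simps)
  qed simp
  also have "1 + \<dots> = (\<Sum>n\<le>Suc N. ?t n) + z * q ^ N * (\<Sum>n\<le>N. ?t n)"
    by (subst sum.atMost_Suc_shift) (simp add: assms binomial_eq_0 sum.distrib sum_distrib_left)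
  also have "(\<Sum>n\<le>Suc N. ?t n) = (\<Sum>n\<le>N. ?t n)"
    by simp
  finally show ?case
    by (simp add: Suc qpoch_Suc algebra_simps)
qed (simp add: assms binomial_eq_0)

text \<open>Both sequences converge, the reciprocals because the limit \<open>qpoch_inf q q\<close>
  is nonzero, and convergent sequences are bounded.\<close>

lemma qpoch_self_bounds:
  assumes "norm q < 1"
  obtains C where "C > 0" "\<And>n. norm (qpoch q q n) \<le> C" "\<And>n. norm (1 / qpoch q q n) \<le> C"
proof -
  have lim: "(\<lambda>n. qpoch q q n) \<longlonglongrightarrow> qpoch_inf q q"
    by (rule qpoch_LIMSEQ[OF assms])
  have lim': "(\<lambda>n. 1 / qpoch q q n) \<longlonglongrightarrow> 1 / qpoch_inf q q"
    by (intro tendsto_intros lim qpoch_inf_self_nonzero assms)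
  then obtain C' where C': "\<And>n. norm (1 / qpoch q q n) \<le> C'"
    using BseqE[OF convergent_imp_Bseq[OF convergentI[OF lim']]] by metis
  obtain C where C: "C > 0" "\<And>n. norm (qpoch q q n) \<le> C"
    using BseqE[OF convergent_imp_Bseq[OF convergentI[OF lim]]] by metis
  show ?thesis
    using C C' by (intro that[of "max C C'"]) (auto simp: le_max_iff_disj)
qed

lemma gauss_binomial_bound:
  assumes "norm q < 1"
  obtains C where "C > 0" "\<And>N n. norm (gauss_binomial q N n) \<le> C"
proof -
  obtain C where C: "C > 0" "\<And>n. norm (qpoch q q n) \<le> C" "\<And>n. norm (1 / qpoch q q n) \<le> C"
    using qpoch_self_bounds[OF assms] by blast
  have "norm (gauss_binomial q N n) \<le> C * (C * C)" for N n
  proof (cases "n \<le> N")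
    case True
    hence "norm (gauss_binomial q N n) =
        norm (qpoch q q N) * (norm (1 / qpoch q q n) * norm (1 / qpoch q q (N - n)))"
      by (simp add: gauss_binomial_def norm_divide norm_mult)
    also have "\<dots> \<le> C * (C * C)"
      using C by (intro mult_mono) (auto intro: less_imp_le)
    finally show ?thesis .
  qed (use C in simp)
  with C(1) show ?thesis
    by (intro that[of "C * (C * C)"]) auto
qed

text \<open>The limit of \<open>rothe\<close> as \<open>N\<close> grows: for fixed \<open>n\<close>
  the Gaussian binomial tends to \<open>1 / qpoch q q n\<close>, and its uniform bound supplies the
  majorant.\<close>

lemma euler_has_sum:
  assumes "norm q < 1"
  shows "((\<lambda>n. q ^ (n choose 2) * z ^ n / qpoch q q n) has_sum qpoch_inf (-z) q) UNIV"
proof -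
  obtain C where C: "C > 0" "\<And>N n. norm (gauss_binomial q N n) \<le> C"
    using gauss_binomial_bound[OF assms] by blast
  show ?thesis
  proof (rule has_sum_tannery[where f = "\<lambda>N n. gauss_binomial q N n * q ^ (n choose 2) * z ^ n"
        and M = "\<lambda>n. C * (norm z ^ n * norm q ^ (n choose 2))"])
    show "norm (gauss_binomial q N n * q ^ (n choose 2) * z ^ n)
        \<le> C * (norm z ^ n * norm q ^ (n choose 2))" for N n
      using mult_right_mono[OF C(2), of "norm z ^ n * norm q ^ (n choose 2)" N n]
      by (simp add: norm_mult norm_power mult_ac)
    show "(\<lambda>n. C * (norm z ^ n * norm q ^ (n choose 2))) summable_on UNIV"
      by (intro summable_on_cmult_right norm_summable_imp_summable_on)
        (use summable_power_choose_two[of "norm q" "norm z"] assms in simp)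
    show "((\<lambda>n. gauss_binomial q N n * q ^ (n choose 2) * z ^ n) has_sum qpoch (-z) q N) UNIV" for N
      unfolding rothe[OF assms] by (rule has_sum_finite_neutralI) auto
    show "(\<lambda>N. qpoch (-z) q N) \<longlonglongrightarrow> qpoch_inf (-z) q"
      by (rule qpoch_LIMSEQ[OF assms])
    show "(\<lambda>N. gauss_binomial q N n * q ^ (n choose 2) * z ^ n)
        \<longlonglongrightarrow> q ^ (n choose 2) * z ^ n / qpoch q q n" for n
    \<comment> \<open>Starting at \<open>N = n\<close> removes both the case distinction and the
      truncated subtraction from \<open>gauss_binomial\<close>.\<close>
    proof (rule LIMSEQ_offset[where k = n])
      have "(\<lambda>N. qpoch q q (N + n) / (qpoch q q n * qpoch q q N) * q ^ (n choose 2) * z ^ n)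
          \<longlonglongrightarrow> qpoch_inf q q / (qpoch q q n * qpoch_inf q q) * q ^ (n choose 2) * z ^ n"
        by (intro tendsto_intros LIMSEQ_ignore_initial_segment qpoch_LIMSEQ assms)
          (simp add: qpoch_self_nonzero qpoch_inf_self_nonzero assms)
      thus "(\<lambda>N. gauss_binomial q (N + n) n * q ^ (n choose 2) * z ^ n)
          \<longlonglongrightarrow> q ^ (n choose 2) * z ^ n / qpoch q q n"
        using qpoch_inf_self_nonzero[OF assms] by (simp add: gauss_binomial_def)
    qed
  qed
qed

section \<open>The Jacobi triple product\<close>

lemma triangular_div:
  fixes s x :: int
  assumes "s * (s - 1) = 2 * x"
  shows "s * (s - 1) div 2 = x"
  using assms by simp

lemma triangular_of_nat: "int n * (int n - 1) div 2 = int (n choose 2)"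
  by (rule triangular_div, induction n) (simp_all add: Suc_choose_two algebra_simps binomial_eq_0)

lemma triangular_neg: "(-1 - int n) * (-1 - int n - 1) div 2 = int (Suc (Suc n) choose 2)"
  by (rule triangular_div, induction n) (simp_all add: Suc_choose_two algebra_simps binomial_eq_0)

text \<open>The integers split into \<open>s = n\<close> and \<open>s = -1 - n\<close> with
  \<open>n\<close> natural; each half is a series with exponents \<open>n choose 2\<close>.\<close>

lemma abs_summable_theta:
  fixes q z :: complex
  assumes "norm q < 1" "q \<noteq> 0" "z \<noteq> 0"
  shows "(\<lambda>s::int. norm (q powi (s * (s - 1) div 2) * z powi s)) summable_on UNIV"
proof -
  let ?f = "\<lambda>s::int. norm (q powi (s * (s - 1) div 2) * z powi s)"
  have "?f summable_on range int"
  proof (subst summable_on_reindex)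
    have "(?f \<circ> int) = (\<lambda>n. norm z ^ n * norm q ^ (n choose 2))"
      by (simp add: fun_eq_iff triangular_of_nat norm_mult norm_power)
    thus "(?f \<circ> int) summable_on UNIV"
      using summable_power_choose_two[of "norm q" "norm z"] assms
      by (auto intro!: norm_summable_imp_summable_on)
  qed simp
  moreover have "?f summable_on range (\<lambda>n. -1 - int n)"
  proof (subst summable_on_reindex)
    \<comment> \<open>Since \<open>Suc (Suc n) choose 2\<close> is
      \<open>(n choose 2) + 2 * n + 1\<close>, the linear part is absorbed into the base
      \<open>q\<^sup>2 / z\<close> and the constant into \<open>q / z\<close>.\<close>
    have "?f (-1 - int n) = norm (q / z) * (norm (q\<^sup>2 / z) ^ n * norm q ^ (n choose 2))" for n
    proof -
      have "z powi (-1 - int n) = z powi (- int (Suc n))"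
        by simp
      also have "\<dots> = 1 / z ^ Suc n"
        by (simp only: power_int_minus_divide power_int_of_nat)
      finally show ?thesis
        unfolding triangular_neg power_int_of_nat
        by (simp add: Suc_choose_two norm_mult norm_power norm_divide power_add power2_eq_square
            power_divide power_mult_distrib mult_ac)
    qed
    hence "(?f \<circ> (\<lambda>n. -1 - int n)) =
        (\<lambda>n. norm (q / z) * (norm (q\<^sup>2 / z) ^ n * norm q ^ (n choose 2)))"
      by (simp add: fun_eq_iff)
    thus "(?f \<circ> (\<lambda>n. -1 - int n)) summable_on UNIV"
      using summable_power_choose_two[of "norm q" "norm (q\<^sup>2 / z)"] assms
      by (auto intro!: norm_summable_imp_summable_on summable_on_cmult_right)
  qed (auto simp: inj_on_def)
  moreover have "range int \<inter> range (\<lambda>n. -1 - int n) = {}"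
    by auto
  ultimately have "?f summable_on (range int \<union> range (\<lambda>n. -1 - int n))"
    by (rule summable_on_Un_disjoint)
  also have "range int \<union> range (\<lambda>n. -1 - int n) = UNIV"
  proof -
    have "s \<in> range int \<union> range (\<lambda>n. -1 - int n)" for s :: int
    proof (cases "s \<ge> 0")
      case True
      hence "s = int (nat s)" by simp
      thus ?thesis by blast
    next
      case False
      hence "s = -1 - int (nat (-1 - s))" by simp
      thus ?thesis by blast
    qed
    thus ?thesis by blast
  qed
  finally show ?thesis .
qed

text \<open>The factors on the left are \<open>1 + z / q ^ i\<close> for \<open>i\<close> from 1 to
  \<open>m\<close>. Taking \<open>z / q ^ i\<close> out of each leaves \<open>1 + q ^ i / z\<close>,
  and the powers of \<open>q\<close> taken out have total exponent
  \<open>Suc m choose 2\<close>.\<close>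

lemma qpoch_reverse:
  assumes "q \<noteq> 0" "z \<noteq> 0"
  shows "qpoch (- (z / q ^ m)) q m * q ^ (Suc m choose 2) = z ^ m * qpoch (- (q / z)) q m"
proof (induction m)
  case (Suc m)
  have "qpoch (- (z / q ^ Suc m)) q (Suc m) = (1 + z / q ^ Suc m) * qpoch (- (z / q ^ m)) q m"
    \<comment> \<open>Passing from \<open>m\<close> to \<open>Suc m\<close> adds a factor at the
      front of this product, so the first factor is split off rather than the last.\<close>
    using qpoch_add[of "- (z / q ^ Suc m)" q 1 m] assms by (simp add: qpoch_def)
  hence "qpoch (- (z / q ^ Suc m)) q (Suc m) * q ^ (Suc (Suc m) choose 2) =
      ((1 + z / q ^ Suc m) * q ^ Suc m) * (qpoch (- (z / q ^ m)) q m * q ^ (Suc m choose 2))"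
    by (simp only: Suc_choose_two[of "Suc m"] power_add mult_ac)
  also have "(1 + z / q ^ Suc m) * q ^ Suc m = q ^ Suc m + z"
    using assms by (simp add: field_simps)
  also have "q ^ Suc m + z = z * (1 - - (q / z) * q ^ m)"
    using assms by (simp add: field_simps)
  also note Suc
  finally show ?case
    by (simp only: qpoch_Suc[of "- (q / z)"] power_Suc mult_ac)
qed (simp add: binomial_eq_0)

lemma finite_jacobi_triple_product:
  assumes "norm q < 1" "q \<noteq> 0" "z \<noteq> 0"
  shows "qpoch (-z) q m * qpoch (- (q / z)) q m =
    (\<Sum>s=-int m..int m. gauss_binomial q (2 * m) (nat (int m + s)) *
       (q powi (s * (s - 1) div 2) * z powi s))"
  \<comment> \<open>Rothe's identity with \<open>2m\<close> factors at \<open>z / q^m\<close>, recentred by \<open>n = m + s\<close>.\<close>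
proof -
  have "z ^ m * (qpoch (-z) q m * qpoch (- (q / z)) q m) =
      q ^ (Suc m choose 2) * (qpoch (- (z / q ^ m)) q m * qpoch (-z) q m)"
    using qpoch_reverse[OF assms(2,3), of m] by (simp add: mult_ac)
  also have "qpoch (- (z / q ^ m)) q m * qpoch (-z) q m = qpoch (- (z / q ^ m)) q (2 * m)"
    using qpoch_add[of "- (z / q ^ m)" q m m] assms by (simp add: mult_2)
  also have "q ^ (Suc m choose 2) * \<dots> = (\<Sum>n\<le>2 * m. z ^ m *
      (gauss_binomial q (2 * m) n * (q powi ((int n - int m) * (int n - int m - 1) div 2)
         * z powi (int n - int m))))"
    unfolding rothe[OF assms(1)] sum_distrib_left
  proof (rule sum.cong)
    fix n
    \<comment> \<open>The first term comes from reversing half of the product, the second from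
      Rothe's identity, and \<open>m * n\<close> from its argument \<open>z / q ^ m\<close>.\<close>
    have "(int n - int m) * (int n - int m - 1) div 2 =
        int (Suc m choose 2) + int (n choose 2) - int (m * n)"
    proof (rule triangular_div)
      have "2 * int (k choose 2) = int k * (int k - 1)" for k
        by (induction k) (simp_all add: Suc_choose_two algebra_simps binomial_eq_0)
      from this[of n] this[of "Suc m"]
      show "(int n - int m) * (int n - int m - 1) =
          2 * (int (Suc m choose 2) + int (n choose 2) - int (m * n))"
        by (simp add: algebra_simps)
    qed
    moreover have "q powi (int a + int b - int c) = q ^ a * q ^ b / q ^ c" for a b c
      using assms by (simp add: power_int_diff power_int_add)
    ultimately have "q powi ((int n - int m) * (int n - int m - 1) div 2) =
        q ^ (Suc m choose 2) * q ^ (n choose 2) / q ^ (m * n)"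
      by (simp only:)
    moreover have "z powi (int n - int m) = z ^ n / z ^ m"
      using assms by (simp add: power_int_diff)
    ultimately show "q ^ (Suc m choose 2) *
        (gauss_binomial q (2 * m) n * q ^ (n choose 2) * (z / q ^ m) ^ n) =
      z ^ m * (gauss_binomial q (2 * m) n * (q powi ((int n - int m) * (int n - int m - 1) div 2)
        * z powi (int n - int m)))"
      using assms by (simp add: power_divide power_mult)
  qed simp
  also have "\<dots> = z ^ m * (\<Sum>s=-int m..int m. gauss_binomial q (2 * m) (nat (int m + s)) *
       (q powi (s * (s - 1) div 2) * z powi s))"
    unfolding sum_distrib_left [symmetric]
    by (intro arg_cong2[where f = "(*)"] refl
        sum.reindex_bij_witness[of _ "\<lambda>s. nat (int m + s)" "\<lambda>n. int n - int m"]) auto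
  finally show ?thesis
    using assms by simp
qed

lemma filterlim_nat_add_int: "filterlim (\<lambda>m. nat (int m + s)) at_top sequentially"
  unfolding filterlim_at_top
proof
  fix Z
  show "\<forall>\<^sub>F m in sequentially. Z \<le> nat (int m + s)"
    using eventually_ge_at_top[of "Z + nat \<bar>s\<bar>"] by eventually_elim linarith
qed

text \<open>The limit of the finite version: for fixed \<open>s\<close> the central Gaussian
  binomials tend to \<open>1 / qpoch_inf q q\<close>, and the range of summation grows to all
  integers.\<close>

lemma jacobi_triple_product:
  assumes "norm q < 1" "q \<noteq> 0" "z \<noteq> 0"
  shows "((\<lambda>s::int. q powi (s * (s - 1) div 2) * z powi s) has_sum
    qpoch_inf (-z) q * qpoch_inf (- (q / z)) q * qpoch_inf q q) UNIV"
proof -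
  obtain C where C: "C > 0" "\<And>N n. norm (gauss_binomial q N n) \<le> C"
    using gauss_binomial_bound[OF assms(1)] by blast
  define t where "t = (\<lambda>s::int. q powi (s * (s - 1) div 2) * z powi s)"
  \<comment> \<open>Below \<open>- int m\<close> the function \<open>nat\<close> would give index 0
    and hence coefficient 1, so 0 is imposed there; above \<open>int m\<close> the value of
    \<open>gauss_binomial\<close> is 0 already.\<close>
  define b where "b = (\<lambda>m s. if - int m \<le> s then gauss_binomial q (2 * m) (nat (int m + s)) else 0)"
  have b_bound: "norm (b m s) \<le> C" for m s
    using C by (auto simp: b_def)
  have "((\<lambda>s. 1 / qpoch_inf q q * t s) has_sum qpoch_inf (-z) q * qpoch_inf (- (q / z)) q) UNIV"
  proof (rule has_sum_tannery[where f = "\<lambda>m s. b m s * t s" and M = "\<lambda>s. C * norm (t s)"])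
    show "norm (b m s * t s) \<le> C * norm (t s)" for m s
      using b_bound by (simp add: norm_mult mult_right_mono)
    show "(\<lambda>s. C * norm (t s)) summable_on UNIV"
      unfolding t_def by (intro summable_on_cmult_right abs_summable_theta assms)
    show "((\<lambda>s. b m s * t s) has_sum qpoch (-z) q m * qpoch (- (q / z)) q m) UNIV" for m
      unfolding finite_jacobi_triple_product[OF assms]
      by (rule has_sum_finite_neutralI[of "{- int m..int m}"]) (auto simp: b_def t_def)
    show "(\<lambda>m. qpoch (-z) q m * qpoch (- (q / z)) q m)
        \<longlonglongrightarrow> qpoch_inf (-z) q * qpoch_inf (- (q / z)) q"
      by (intro tendsto_intros qpoch_LIMSEQ assms)
    show "(\<lambda>m. b m s * t s) \<longlonglongrightarrow> 1 / qpoch_inf q q * t s" for s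
    proof (intro tendsto_mult_right)
      have *: "(\<lambda>m. qpoch q q (nat (int m + k))) \<longlonglongrightarrow> qpoch_inf q q" for k
        by (rule filterlim_compose[OF qpoch_LIMSEQ[OF assms(1)] filterlim_nat_add_int])
      have "(\<lambda>m. qpoch q q (2 * m)) \<longlonglongrightarrow> qpoch_inf q q"
        by (rule filterlim_compose[OF qpoch_LIMSEQ[OF assms(1)]])
          (intro filterlim_subseq, auto intro!: strict_monoI)
      hence "(\<lambda>m. qpoch q q (2 * m) / (qpoch q q (nat (int m + s)) * qpoch q q (nat (int m + - s))))
          \<longlonglongrightarrow> qpoch_inf q q / (qpoch_inf q q * qpoch_inf q q)"
        by (intro tendsto_intros *) (auto simp: qpoch_inf_self_nonzero assms)
      also have "qpoch_inf q q / (qpoch_inf q q * qpoch_inf q q) = 1 / qpoch_inf q q"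
        by simp
      finally show "(\<lambda>m. b m s) \<longlonglongrightarrow> 1 / qpoch_inf q q"
      proof (rule Lim_transform_eventually)
        show "\<forall>\<^sub>F m in sequentially. qpoch q q (2 * m) /
            (qpoch q q (nat (int m + s)) * qpoch q q (nat (int m + - s))) = b m s"
          using eventually_ge_at_top[of "nat \<bar>s\<bar>"]
        proof eventually_elim
          case (elim m)
          hence "- int m \<le> s" "nat (int m + s) \<le> 2 * m" "2 * m - nat (int m + s) = nat (int m - s)"
            by linarith+
          thus ?case
            by (simp add: b_def gauss_binomial_def)
        qed
      qed
    qed
  qed
  from has_sum_cmult_right[OF this, of "qpoch_inf q q"] show ?thesis
    using qpoch_inf_self_nonzero[OF assms(1)] by (simp add: t_def mult_ac)
qed

text \<open>The triple product series is split by the parity of its index. With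
  \<open>t = s * (s - 1) div 2\<close>, the exponent of \<open>q\<close> is \<open>4 * t + s\<close>
  at index \<open>2 * s\<close> and \<open>4 * t + 3 * s\<close> at \<open>2 * s + 1\<close>, so
  both halves are triple products in base \<open>q ^ 4\<close>.\<close>

lemma theta_dissection:
  assumes "norm q < 1" "q \<noteq> 0" "z \<noteq> 0"
  shows "qpoch_inf (-z) q * qpoch_inf (- (q / z)) q * qpoch_inf q q =
    qpoch_inf (- (z\<^sup>2 * q)) (q ^ 4) * qpoch_inf (- (q ^ 3 / z\<^sup>2)) (q ^ 4) * qpoch_inf (q ^ 4) (q ^ 4) +
    z * (qpoch_inf (- (z\<^sup>2 * q ^ 3)) (q ^ 4) * qpoch_inf (- (q / z\<^sup>2)) (q ^ 4) * qpoch_inf (q ^ 4) (q ^ 4))"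
    (is "?T = ?A + z * ?B")
proof -
  let ?t = "\<lambda>s::int. q powi (s * (s - 1) div 2) * z powi s"
  have q4: "norm (q ^ 4) < 1" "q ^ 4 \<noteq> 0"
    using assms norm_power_less_1[of q 4] by auto
  have tri: "s * s = s + 2 * (s * (s - 1) div 2)" for s :: int
    using dvd_mult_div_cancel[of 2 "s * (s - 1)"] by (simp add: algebra_simps)
  have sq: "(x\<^sup>2) powi s = x powi (2 * s)" for x :: complex and s
    by (simp add: power_int_power)
  have even: "?t (2 * s) = (q ^ 4) powi (s * (s - 1) div 2) * (z\<^sup>2 * q) powi s" for s
  proof -
    define t where "t = s * (s - 1) div 2"
    have e: "2 * s * (2 * s - 1) div 2 = 4 * t + s"
      by (rule triangular_div) (use tri[of s, folded t_def] in \<open>simp add: algebra_simps\<close>)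
    show ?thesis
      unfolding t_def [symmetric] e
      using assms by (simp only: power_int_mult_distrib sq power_int_power power_int_add mult_ac)
         (simp add: power_int_add)
  qed
  have odd: "?t (2 * s + 1) = z * ((q ^ 4) powi (s * (s - 1) div 2) * (z\<^sup>2 * q ^ 3) powi s)" for s
  proof -
    define t where "t = s * (s - 1) div 2"
    have e: "(2 * s + 1) * (2 * s + 1 - 1) div 2 = 4 * t + 3 * s"
      by (rule triangular_div) (use tri[of s, folded t_def] in \<open>simp add: algebra_simps\<close>)
    show ?thesis
      unfolding t_def [symmetric] e
      using assms by (simp only: power_int_mult_distrib sq power_int_power mult_ac)
        (simp add: power_int_add)
  qed
  have "(?t has_sum ?A) (range (\<lambda>s. 2 * s))"
  proof (subst has_sum_reindex)
    have "q ^ 4 / (z\<^sup>2 * q) = q ^ 3 / z\<^sup>2"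
      using assms by (simp add: field_simps power4_eq_xxxx power3_eq_cube)
    thus "(?t \<circ> (\<lambda>s. 2 * s) has_sum ?A) UNIV"
      using jacobi_triple_product[OF q4, of "z\<^sup>2 * q"] assms
      unfolding o_def even by simp
  qed (auto simp: inj_on_def)
  moreover have "(?t has_sum z * ?B) (range (\<lambda>s. 2 * s + 1))"
  proof (subst has_sum_reindex)
    have "q ^ 4 / (z\<^sup>2 * q ^ 3) = q / z\<^sup>2"
      using assms by (simp add: field_simps power4_eq_xxxx power3_eq_cube)
    thus "(?t \<circ> (\<lambda>s. 2 * s + 1) has_sum z * ?B) UNIV"
      using has_sum_cmult_right[OF jacobi_triple_product[OF q4, of "z\<^sup>2 * q ^ 3"], of z] assms
      unfolding o_def odd by simp
  qed (auto simp: inj_on_def)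
  moreover have "range (\<lambda>s::int. 2 * s) \<inter> range (\<lambda>s. 2 * s + 1) = {}"
    by (auto; presburger)
  ultimately have "(?t has_sum ?A + z * ?B) (range (\<lambda>s. 2 * s) \<union> range (\<lambda>s. 2 * s + 1))"
    by (rule has_sum_Un_disjoint)
  also have "range (\<lambda>s::int. 2 * s) \<union> range (\<lambda>s. 2 * s + 1) = UNIV"
    by (auto simp: image_iff) presburger
  finally show ?thesis
    using has_sum_unique[OF jacobi_triple_product[OF assms]] by simp
qed

section \<open>Double sums\<close>

text \<open>Half the sum and half the difference of Euler's identity at \<open>z\<close> and
  \<open>-z\<close>; the terms of the other parity cancel.\<close>

lemma euler_even_odd:
  assumes "norm q < 1"
  shows euler_even: "((\<lambda>i. q ^ (2 * i choose 2) * z ^ (2 * i) / qpoch q q (2 * i))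
          has_sum (qpoch_inf (-z) q + qpoch_inf z q) / 2) UNIV"
    and euler_odd: "((\<lambda>i. q ^ ((2 * i + 1) choose 2) * z ^ (2 * i + 1) / qpoch q q (2 * i + 1))
          has_sum (qpoch_inf (-z) q - qpoch_inf z q) / 2) UNIV"
proof -
  let ?e = "\<lambda>z n. q ^ (n choose 2) * z ^ n / qpoch q q n"
  have plus: "(?e z has_sum qpoch_inf (-z) q) UNIV" and minus: "(?e (-z) has_sum qpoch_inf z q) UNIV"
    using euler_has_sum[OF assms, of z] euler_has_sum[OF assms, of "-z"] by simp_all
  have even: "range (\<lambda>i::nat. 2 * i) = {n. even n}" and odd: "range (\<lambda>i::nat. 2 * i + 1) = {n. odd n}"
    by (auto elim: evenE oddE)
  have "((\<lambda>n. (?e z n + ?e (-z) n) / 2) has_sum (qpoch_inf (-z) q + qpoch_inf z q) / 2) UNIV"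
    by (intro has_sum_divide_const has_sum_add plus minus)
  also have "?this \<longleftrightarrow> ((\<lambda>n. (?e z n + ?e (-z) n) / 2)
      has_sum (qpoch_inf (-z) q + qpoch_inf z q) / 2) (range (\<lambda>i. 2 * i))"
    by (rule has_sum_cong_neutral) (unfold even, auto)
  finally show "((\<lambda>i. ?e z (2 * i)) has_sum (qpoch_inf (-z) q + qpoch_inf z q) / 2) UNIV"
    by (subst (asm) has_sum_reindex) (auto simp: inj_on_def o_def mult_ac)
  have "((\<lambda>n. (?e z n + - ?e (-z) n) / 2) has_sum (qpoch_inf (-z) q + - qpoch_inf z q) / 2) UNIV"
    by (intro has_sum_divide_const has_sum_add has_sum_uminusI plus minus)
  also have "?this \<longleftrightarrow> ((\<lambda>n. (?e z n + - ?e (-z) n) / 2)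
      has_sum (qpoch_inf (-z) q + - qpoch_inf z q) / 2) (range (\<lambda>i. 2 * i + 1))"
    by (rule has_sum_cong_neutral) (unfold odd, auto)
  finally show "((\<lambda>i. ?e z (2 * i + 1)) has_sum (qpoch_inf (-z) q - qpoch_inf z q) / 2) UNIV"
    by (subst (asm) has_sum_reindex) (auto simp: inj_on_def o_def mult_ac)
qed

text \<open>For fixed \<open>i\<close>, Euler's identity at \<open>q ^ Suc (m i)\<close> sums over
  \<open>j\<close>. The result is \<open>qpoch_inf (-q) q\<close> divided by
  \<open>qpoch (-q) q (m i)\<close>, and that divisor times \<open>qpoch q q (m i)\<close> is the
  denominator in base \<open>q\<^sup>2\<close>. The bound on \<open>e\<close> serves absolute
  summability over pairs.\<close>

lemma euler_double_sum:
  assumes q: "norm q < 1" and e: "\<And>i. i \<le> e i"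
    and S: "((\<lambda>i. q ^ e i / qpoch (q\<^sup>2) (q\<^sup>2) (m i)) has_sum S) UNIV"
  shows "((\<lambda>(i, j). q ^ (e i + (Suc j choose 2) + m i * j) / (qpoch q q (m i) * qpoch q q j))
      has_sum qpoch_inf (-q) q * S) (UNIV :: (nat \<times> nat) set)"
proof -
  let ?f = "\<lambda>(i, j). q ^ (e i + (Suc j choose 2) + m i * j) / (qpoch q q (m i) * qpoch q q j)"
  have "((\<lambda>j. ?f (i, j)) has_sum qpoch_inf (-q) q * (q ^ e i / qpoch (q\<^sup>2) (q\<^sup>2) (m i))) UNIV" for i
  proof -
    have nz: "qpoch (q\<^sup>2) (q\<^sup>2) (m i) \<noteq> 0"
      using norm_power_less_1[OF q, of 2] by (intro qpoch_self_nonzero) simp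
    have "((\<lambda>j. q ^ e i / qpoch q q (m i) * (q ^ (j choose 2) * (q ^ Suc (m i)) ^ j / qpoch q q j))
        has_sum q ^ e i / qpoch q q (m i) * qpoch_inf (- (q ^ Suc (m i))) q) UNIV"
      by (intro has_sum_cmult_right euler_has_sum q)
    also have "(\<lambda>j. q ^ e i / qpoch q q (m i) * (q ^ (j choose 2) * (q ^ Suc (m i)) ^ j / qpoch q q j))
        = (\<lambda>j. ?f (i, j))"
      by (simp add: fun_eq_iff Suc_choose_two power_add power_mult power_mult_distrib)
    also have "q ^ e i / qpoch q q (m i) * qpoch_inf (- (q ^ Suc (m i))) q =
        qpoch_inf (-q) q * (q ^ e i / qpoch (q\<^sup>2) (q\<^sup>2) (m i))"
      using nz unfolding qpoch_inf_shift[OF q, of "-q" "m i"] qpoch_mult_minus[symmetric]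
      by (simp add: field_simps)
    finally show ?thesis .
  qed
  moreover have "((\<lambda>i. qpoch_inf (-q) q * (q ^ e i / qpoch (q\<^sup>2) (q\<^sup>2) (m i))) has_sum
      qpoch_inf (-q) q * S) UNIV"
    by (intro has_sum_cmult_right S)
  moreover have "?f summable_on UNIV \<times> UNIV"
  proof -
    obtain C where C: "C > 0" "\<And>n. norm (1 / qpoch q q n) \<le> C"
      using qpoch_self_bounds[OF q] by metis
    have geom: "(\<lambda>n. norm q ^ n) summable_on UNIV"
      using q by (intro norm_summable_imp_summable_on) (simp add: summable_geometric)
    have "(\<lambda>p. norm q ^ fst p * norm q ^ snd p) summable_on UNIV \<times> UNIV"
      by (rule summable_on_SigmaI[where g = "\<lambda>i. norm q ^ i * (\<Sum>\<^sub>\<infinity>j. norm q ^ j)"])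
        (auto intro!: has_sum_cmult_right summable_on_cmult_left has_sum_infsum geom)
    hence "(\<lambda>p. C * C * (norm q ^ fst p * norm q ^ snd p)) summable_on UNIV \<times> UNIV"
      by (rule summable_on_cmult_right)
    hence "(\<lambda>p. norm (?f p)) summable_on UNIV \<times> UNIV"
    proof (rule summable_on_comparison_test)
      fix p :: "nat \<times> nat"
      obtain i j where p: "p = (i, j)" by fastforce
      \<comment> \<open>With \<open>i \<le> e i\<close> this makes the exponent at least
        \<open>i + j\<close>, so a product of two geometric series dominates.\<close>
      have "j \<le> (Suc j choose 2)"
        by (simp add: Suc_choose_two)
      hence "i + j \<le> e i + (Suc j choose 2) + m i * j"
        using e[of i] by linarith
      hence "norm q ^ (e i + (Suc j choose 2) + m i * j) \<le> norm q ^ (i + j)"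
        using q by (intro power_decreasing) auto
      moreover have "norm (1 / qpoch q q (m i)) * norm (1 / qpoch q q j) \<le> C * C"
        using C by (intro mult_mono) (auto intro: less_imp_le)
      ultimately have "(norm (1 / qpoch q q (m i)) * norm (1 / qpoch q q j)) *
          norm q ^ (e i + (Suc j choose 2) + m i * j) \<le> (C * C) * norm q ^ (i + j)"
        using C by (intro mult_mono) auto
      thus "norm (?f p) \<le> C * C * (norm q ^ fst p * norm q ^ snd p)"
        by (simp add: p norm_divide norm_mult norm_power power_add)
    qed auto
    thus ?thesis
      by (rule abs_summable_summable)
  qed
  ultimately have "(?f has_sum qpoch_inf (-q) q * S) (UNIV \<times> UNIV)"
    by (intro has_sum_SigmaI)
  thus ?thesis
    by simp
qed

text \<open>Euler's theorem on partitions into odd and into distinct parts, in product form: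
  \<open>qpoch_inf q q\<close> is split by parity of the exponents and then cancelled.\<close>

lemma qpoch_inf_odd_inverse:
  assumes "norm q < 1"
  shows "qpoch_inf q (q\<^sup>2) * qpoch_inf (-q) q = 1"
proof -
  have q2: "norm (q\<^sup>2) < 1"
    using assms by (intro norm_power_less_1) auto
  have "qpoch_inf q q = qpoch_inf q (q\<^sup>2) * qpoch_inf (q\<^sup>2) (q\<^sup>2)"
    using qpoch_inf_split[OF assms, of q] by (simp add: power2_eq_square)
  moreover have "qpoch_inf q q * qpoch_inf (-q) q = qpoch_inf (q\<^sup>2) (q\<^sup>2)"
    by (rule qpoch_inf_mult_minus[OF assms])
  ultimately show ?thesis
    using qpoch_inf_self_nonzero[OF q2] by (simp add: field_simps)
qed

text \<open>\<open>theta_dissection\<close> in base \<open>q ^ 4\<close> at \<open>z = q\<close> and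
  \<open>z = -q\<close>; the sign affects only the odd half. On the left, the factors in base
  \<open>q ^ 4\<close> merge into one product in base \<open>q\<^sup>2\<close>.\<close>

lemma theta_pair:
  fixes q :: complex
  assumes "norm q < 1" "q \<noteq> 0"
  shows "qpoch_inf (-q) (q\<^sup>2) * qpoch_inf (q ^ 4) (q ^ 4) =
      qpochs_inf [- (q ^ 6), - (q ^ 10), q ^ 16] (q ^ 16) +
      q * qpochs_inf [- (q ^ 2), - (q ^ 14), q ^ 16] (q ^ 16)"
    and "qpoch_inf q (q\<^sup>2) * qpoch_inf (q ^ 4) (q ^ 4) =
      qpochs_inf [- (q ^ 6), - (q ^ 10), q ^ 16] (q ^ 16) -
      q * qpochs_inf [- (q ^ 2), - (q ^ 14), q ^ 16] (q ^ 16)"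
proof -
  have q: "norm (q\<^sup>2) < 1" "norm (q ^ 4) < 1" "q ^ 4 \<noteq> 0"
    using assms by (simp_all add: norm_power_less_1)
  have div: "q ^ 4 / q = q ^ 3" "q ^ 12 / q\<^sup>2 = q ^ 10" "q ^ 4 / q\<^sup>2 = q\<^sup>2"
    using assms by (simp_all add: divide_eq_eq flip: power_Suc2)
  show "qpoch_inf (-q) (q\<^sup>2) * qpoch_inf (q ^ 4) (q ^ 4) =
      qpochs_inf [- (q ^ 6), - (q ^ 10), q ^ 16] (q ^ 16) +
      q * qpochs_inf [- (q ^ 2), - (q ^ 14), q ^ 16] (q ^ 16)"
    using theta_dissection[OF q(2,3) assms(2)] qpoch_inf_split[OF q(1), of "-q"]
    by (simp add: div qpochs_inf_def mult_ac flip: power_Suc)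
  show "qpoch_inf q (q\<^sup>2) * qpoch_inf (q ^ 4) (q ^ 4) =
      qpochs_inf [- (q ^ 6), - (q ^ 10), q ^ 16] (q ^ 16) -
      q * qpochs_inf [- (q ^ 2), - (q ^ 14), q ^ 16] (q ^ 16)"
    using theta_dissection[OF q(2,3), of "-q"] qpoch_inf_split[OF q(1), of q] assms(2)
    by (simp add: div qpochs_inf_def mult_ac flip: power_Suc)
qed

lemma even_square_sum:
  assumes "norm q < 1"
  shows "((\<lambda>i. q ^ (4 * i\<^sup>2) / qpoch (q\<^sup>2) (q\<^sup>2) (2 * i)) has_sum
    qpochs_inf [- (q ^ 6), - (q ^ 10), q ^ 16] (q ^ 16) / qpoch_inf (q ^ 4) (q ^ 4)) UNIV"
proof (cases "q = 0")
  case True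
  show ?thesis
    by (rule has_sum_finite_neutralI[of "{0}"]) (auto simp: True qpochs_inf_def)
next
  case False
  have q: "norm (q\<^sup>2) < 1" "qpoch_inf (q ^ 4) (q ^ 4) \<noteq> 0"
    using assms by (simp_all add: norm_power_less_1 qpoch_inf_self_nonzero)
  have "(q\<^sup>2) ^ (2 * i choose 2) * q ^ (2 * i) = q ^ (4 * i\<^sup>2)" for i
    using choose_two_square[of "2 * i"] by (simp add: power_mult_distrib flip: power_mult power_add)
  moreover have "(qpoch_inf (-q) (q\<^sup>2) + qpoch_inf q (q\<^sup>2)) / 2 =
      qpochs_inf [- (q ^ 6), - (q ^ 10), q ^ 16] (q ^ 16) / qpoch_inf (q ^ 4) (q ^ 4)"
    using theta_pair[OF assms False] q(2) by (simp add: field_simps)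
  ultimately show ?thesis
    using euler_even[OF q(1), of q] by simp
qed

lemma odd_square_sum:
  assumes "norm q < 1"
  shows "((\<lambda>i. q ^ (4 * i\<^sup>2 + 4 * i) / qpoch (q\<^sup>2) (q\<^sup>2) (2 * i + 1)) has_sum
    qpochs_inf [- (q ^ 2), - (q ^ 14), q ^ 16] (q ^ 16) / qpoch_inf (q ^ 4) (q ^ 4)) UNIV"
proof (cases "q = 0")
  case True
  show ?thesis
    by (rule has_sum_finite_neutralI[of "{0}"]) (auto simp: True qpochs_inf_def)
next
  case False
  have q: "norm (q\<^sup>2) < 1" "qpoch_inf (q ^ 4) (q ^ 4) \<noteq> 0"
    using assms by (simp_all add: norm_power_less_1 qpoch_inf_self_nonzero)
  have "(q\<^sup>2) ^ ((2 * i + 1) choose 2) * q ^ (2 * i + 1) = q * q ^ (4 * i\<^sup>2 + 4 * i)" for i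
  proof -
    \<comment> \<open>The exponent is the odd square \<open>(2 * i + 1)\<^sup>2\<close>; its surplus
      factor \<open>q\<close> is divided out below.\<close>
    have "2 * ((2 * i + 1) choose 2) + (2 * i + 1) = Suc (4 * i\<^sup>2 + 4 * i)"
      unfolding choose_two_square by (simp add: power2_eq_square)
    thus ?thesis
      by (metis power_Suc power_add power_mult)
  qed
  moreover have "(qpoch_inf (-q) (q\<^sup>2) - qpoch_inf q (q\<^sup>2)) / 2 / q =
      qpochs_inf [- (q ^ 2), - (q ^ 14), q ^ 16] (q ^ 16) / qpoch_inf (q ^ 4) (q ^ 4)"
  proof -
    have "(qpoch_inf (-q) (q\<^sup>2) - qpoch_inf q (q\<^sup>2)) * qpoch_inf (q ^ 4) (q ^ 4) =
        2 * q * qpochs_inf [- (q ^ 2), - (q ^ 14), q ^ 16] (q ^ 16)"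
      unfolding left_diff_distrib theta_pair[OF assms False] by simp
    thus ?thesis
      using q(2) False by (simp add: field_simps)
  qed
  ultimately show ?thesis
    using has_sum_divide_const[OF euler_odd[OF q(1), of q], of q] False by simp
qed

text \<open>At \<open>z = 1\<close> one of the two products in \<open>euler_even_odd\<close>
  vanishes and the factor 2 of the other cancels the half. Hence even and odd parts agree, which is
  why the first two formulas share a right-hand side.\<close>

lemma qpoch_inf_one_minus_one:
  assumes "norm q < 1"
  shows "qpoch_inf 1 q = 0" "qpoch_inf (-1) q = 2 * qpoch_inf (-q) q"
  using qpoch_inf_shift[OF assms, of 1 1] qpoch_inf_shift[OF assms, of "-1" 1]
  by (simp_all add: qpoch_def)

text \<open>Two parity splittings separate the exponents congruent to 2 modulo 4 into the residues
  2, 6, 10, 14 modulo 16.\<close>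

lemma qpoch_inf_mod_16:
  assumes "norm q < 1"
  shows "qpoch_inf (-q) q / qpoch_inf (q ^ 4) (q ^ 4) =
    qpochs_inf [q ^ 2, q ^ 6, q ^ 10, q ^ 14] (q ^ 16) / qpoch_inf q q"
proof -
  have n: "norm (q ^ 2) < 1" "norm (q ^ 4) < 1" "norm (q ^ 8) < 1"
    using assms by (simp_all add: norm_power_less_1)
  have "qpoch_inf q q * qpoch_inf (-q) q = qpoch_inf (q\<^sup>2) (q ^ 4) * qpoch_inf (q ^ 4) (q ^ 4)"
    using qpoch_inf_mult_minus[OF assms, of q] qpoch_inf_split[OF n(1), of "q\<^sup>2"] by simp
  moreover have "qpoch_inf (q\<^sup>2) (q ^ 4) = qpochs_inf [q ^ 2, q ^ 6, q ^ 10, q ^ 14] (q ^ 16)"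
    using qpoch_inf_split[OF n(2), of "q\<^sup>2"] qpoch_inf_split[OF n(3), of "q\<^sup>2"]
      qpoch_inf_split[OF n(3), of "q ^ 6"]
    by (simp add: qpochs_inf_def mult_ac)
  ultimately show ?thesis
    using qpoch_inf_self_nonzero[OF assms] qpoch_inf_self_nonzero[OF n(2)]
    by (simp add: field_simps)
qed

theorem theorem5p7:
  fixes q :: complex
  assumes "norm q < 1"
  shows
    "((\<lambda>(i, j). q ^ (4 * i\<^sup>2 + 2 * i * j + (j\<^sup>2 + j) div 2 - 2 * i)
          / (qpoch q q (2 * i) * qpoch q q j))
        has_sum 1 / (qpoch_inf q (q ^ 2) * qpoch_inf (q ^ 2) (q ^ 4)))
      (UNIV :: (nat \<times> nat) set) \<and>
     ((\<lambda>(i, j). q ^ (4 * i\<^sup>2 + 2 * i * j + (j\<^sup>2 + 3 * j) div 2 + 2 * i)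
          / (qpoch q q (2 * i + 1) * qpoch q q j))
        has_sum 1 / (qpoch_inf q (q ^ 2) * qpoch_inf (q ^ 2) (q ^ 4)))
      (UNIV :: (nat \<times> nat) set) \<and>
     ((\<lambda>(i, j). q ^ (4 * i\<^sup>2 + 2 * i * j + (j\<^sup>2 + j) div 2)
          / (qpoch q q (2 * i) * qpoch q q j))
        has_sum qpochs_inf [q ^ 2, q ^ 14, q ^ 16] (q ^ 16) * qpochs_inf [q ^ 12, q ^ 20] (q ^ 32)
          / qpoch_inf q q)
      (UNIV :: (nat \<times> nat) set) \<and>
     ((\<lambda>(i, j). q ^ (4 * i\<^sup>2 + 2 * i * j + (j\<^sup>2 + 3 * j) div 2 + 4 * i)
          / (qpoch q q (2 * i + 1) * qpoch q q j))
        has_sum qpochs_inf [q ^ 6, q ^ 10, q ^ 16] (q ^ 16) * qpochs_inf [q ^ 4, q ^ 28] (q ^ 32)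
          / qpoch_inf q q)
      (UNIV :: (nat \<times> nat) set)"
proof -
  have n: "norm (q\<^sup>2) < 1" "norm (q ^ 16) < 1"
    using assms by (simp_all add: norm_power_less_1)
  have tri: "(j\<^sup>2 + j) div 2 = (Suc j choose 2)" "(j\<^sup>2 + 3 * j) div 2 = (Suc j choose 2) + j" for j
    using choose_two_square[of j] by (simp_all add: Suc_choose_two)
  have sq_even: "4 * i\<^sup>2 = 2 * (2 * i choose 2) + 2 * i" for i
    unfolding choose_two_square by (simp add: power2_eq_square)
  have sq_odd: "4 * i\<^sup>2 + 2 * i = 2 * ((2 * i + 1) choose 2)" for i
    using choose_two_square[of "2 * i + 1"] by (simp add: power2_eq_square)
  have prod1: "1 / (qpoch_inf q (q ^ 2) * qpoch_inf (q ^ 2) (q ^ 4)) =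
      qpoch_inf (-q) q * qpoch_inf (- (q\<^sup>2)) (q\<^sup>2)"
    using qpoch_inf_odd_inverse[OF assms] qpoch_inf_odd_inverse[OF n(1)]
    by (auto simp: divide_eq_eq mult_ac)
  \<comment> \<open>The exponents are brought to the form
    \<open>e i + (Suc j choose 2) + m i * j\<close> of \<open>euler_double_sum\<close>. Here
    \<open>4 * i\<^sup>2 - 2 * i\<close> is twice \<open>2 * i choose 2\<close>; in
    \<open>exp2\<close> and \<open>exp4\<close> the extra \<open>j\<close> turns
    \<open>2 * i * j\<close> into \<open>(2 * i + 1) * j\<close>.\<close>
  have exp1: "4 * i\<^sup>2 + 2 * i * j + (j\<^sup>2 + j) div 2 - 2 * i =
      2 * (2 * i choose 2) + (Suc j choose 2) + 2 * i * j" for i j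
    unfolding tri sq_even by simp
  have exp2: "4 * i\<^sup>2 + 2 * i * j + (j\<^sup>2 + 3 * j) div 2 + 2 * i =
      2 * ((2 * i + 1) choose 2) + (Suc j choose 2) + (2 * i + 1) * j" for i j
    unfolding tri sq_odd [symmetric] by (simp add: algebra_simps)
  have exp3: "4 * i\<^sup>2 + 2 * i * j + (j\<^sup>2 + j) div 2 = 4 * i\<^sup>2 + (Suc j choose 2) + 2 * i * j" for i j
    unfolding tri by simp
  have exp4: "4 * i\<^sup>2 + 2 * i * j + (j\<^sup>2 + 3 * j) div 2 + 4 * i =
      (4 * i\<^sup>2 + 4 * i) + (Suc j choose 2) + (2 * i + 1) * j" for i j
    unfolding tri by (simp add: algebra_simps)
  have le: "i \<le> 4 * i\<^sup>2" "i \<le> 4 * i\<^sup>2 + 4 * i" "i \<le> 2 * ((2 * i + 1) choose 2)"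
    "i \<le> 2 * (2 * i choose 2)" for i
  proof -
    have "i \<le> i\<^sup>2"
      by (simp add: power2_eq_square)
    thus "i \<le> 4 * i\<^sup>2" "i \<le> 4 * i\<^sup>2 + 4 * i" "i \<le> 2 * ((2 * i + 1) choose 2)"
      "i \<le> 2 * (2 * i choose 2)"
      using sq_even[of i] sq_odd[of i] by linarith+
  qed
  have E: "((\<lambda>i. q ^ (2 * (2 * i choose 2)) / qpoch (q\<^sup>2) (q\<^sup>2) (2 * i))
      has_sum qpoch_inf (- (q\<^sup>2)) (q\<^sup>2)) UNIV"
    using euler_even[OF n(1), of 1] by (simp add: qpoch_inf_one_minus_one[OF n(1)] power_mult)
  have O: "((\<lambda>i. q ^ (2 * ((2 * i + 1) choose 2)) / qpoch (q\<^sup>2) (q\<^sup>2) (2 * i + 1))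
      has_sum qpoch_inf (- (q\<^sup>2)) (q\<^sup>2)) UNIV"
    using euler_odd[OF n(1), of 1] by (simp add: qpoch_inf_one_minus_one[OF n(1)] power_mult)
  \<comment> \<open>Of the residues 2, 6, 10, 14, two pair with the negated arguments via
    \<open>qpoch_inf_mult_minus\<close> to give base \<open>q ^ 32\<close>: here 6 and 10 become 12
    and 20; in \<open>prod4\<close>, 2 and 14 become 4 and 28.\<close>
  have prod3: "qpoch_inf (-q) q * (qpochs_inf [- (q ^ 6), - (q ^ 10), q ^ 16] (q ^ 16) /
        qpoch_inf (q ^ 4) (q ^ 4)) =
      qpochs_inf [q ^ 2, q ^ 14, q ^ 16] (q ^ 16) * qpochs_inf [q ^ 12, q ^ 20] (q ^ 32)
        / qpoch_inf q q"
    using arg_cong[OF qpoch_inf_mod_16[OF assms],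
        of "\<lambda>x. x * qpochs_inf [- (q ^ 6), - (q ^ 10), q ^ 16] (q ^ 16)"]
      qpoch_inf_mult_minus[OF n(2), of "q ^ 6", symmetric]
      qpoch_inf_mult_minus[OF n(2), of "q ^ 10", symmetric]
    by (simp add: qpochs_inf_def mult_ac)
  have prod4: "qpoch_inf (-q) q * (qpochs_inf [- (q ^ 2), - (q ^ 14), q ^ 16] (q ^ 16) /
        qpoch_inf (q ^ 4) (q ^ 4)) =
      qpochs_inf [q ^ 6, q ^ 10, q ^ 16] (q ^ 16) * qpochs_inf [q ^ 4, q ^ 28] (q ^ 32)
        / qpoch_inf q q"
    using arg_cong[OF qpoch_inf_mod_16[OF assms],
        of "\<lambda>x. x * qpochs_inf [- (q ^ 2), - (q ^ 14), q ^ 16] (q ^ 16)"]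
      qpoch_inf_mult_minus[OF n(2), of "q ^ 2", symmetric]
      qpoch_inf_mult_minus[OF n(2), of "q ^ 14", symmetric]
    by (simp add: qpochs_inf_def mult_ac)
  show ?thesis
    \<comment> \<open>The left side of \<open>exp3\<close> occurs inside that of
      \<open>exp1\<close>, so \<open>exp1\<close> is applied first.\<close>
    unfolding prod1 exp1 exp2 unfolding exp3 exp4 prod3 [symmetric] prod4 [symmetric]
    by (intro conjI euler_double_sum assms E O even_square_sum odd_square_sum le)
qed

end
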